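(* Let $A,B_1,\ldots,B_m\in\mathcal{M}_D^{\mathrm{sym}}$ and $\gamma_1,\ldots,\gamma_m\in\mathbb{R}$ define a sketchable SDP with an optimal point $X^*$. Let $z:=\max\{\mathrm{nnz}(A),\mathrm{nnz}(B_1),\ldots,\mathrm{nnz}(B_m)\}$ and let $\mathrm{SDP}(m,d,\zeta)$ be the complexity of solving a sketchable SDP of dimension $d$ with $m$ constraints up to accuracy $\zeta$. Let $$k\ \ge\ \operatorname{rank}(X^* )+\operatorname{rank}(A)+\sum_{i=1}^m\operatorname{rank}(B_i).$$ Then, using as $S$ a sparse $(\epsilon,\delta,k)$-Johnson-Lindenstrauss transform, a number of $$\mathcal{O}\Big(\max\{z,\ D\epsilon^{-2}\log(k\delta^{-1})\}\,\epsilon^{-1}m\log(k\delta^{-1})+\mathrm{SDP}\big(m,\ \epsilon^{-2}\log(k\delta^{-1}),\ \zeta\big)\Big)$$ operations is needed (i.e. suffices) to generate and solve (up to accuracy $\zeta$) the sketched SDP.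
   Context: $\mathcal{M}_D^{\mathrm{sym}}$ is the set of real symmetric $D\times D$ matrices; $X\ge0$ means that $X$ is symmetric positive semidefinite; $\mathrm{nnz}(B)$ is the number of nonzero entries of $B$; $\|B\|_1=\operatorname{Tr}[(B^TB)^{1/2}]$ is the Schatten $1$-norm. Operations are arithmetic operations. The sketchable SDP is: maximize $\operatorname{Tr}(AX)$ subject to $\operatorname{Tr}(B_iX)\le\gamma_i$ for $i=1,\ldots,m$, and $X\ge0$, over $X\in\mathcal{M}_D^{\mathrm{sym}}$; its dimension is $D$. Given $\eta\ge\operatorname{Tr}(X^* )$, $\epsilon>0$ and $S\in\mathbb{R}^{d\times D}$, the sketched SDP is: maximize $\operatorname{Tr}(SAS^TY)$ subject to $\operatorname{Tr}(SB_iS^TY)\le\gamma_i+3\epsilon\eta\|B_i\|_1$ for $i=1,\ldots,m$, and $Y\ge0$, over $Y\in\mathcal{M}_d^{\mathrm{sym}}$. Generating it means computing $SAS^T$ and all $SB_iS^T$. Standing assumption: the Schatten $1$-norms of an optimal solution and of the matrices defining the constraints are $\mathcal{O}(1)$, and upper bounds on them are given (so that no operations are counted for computing them). A random matrix $S\in\mathbb{R}^{d\times D}$ is a Johnson-Lindenstrauss transform (JLT) with parameters $(\epsilon,\delta,k)$ if for every fixed $k$-element subset $V\subseteq\mathbb{R}^D$, with probability at least $1-\delta$ it holds that for all $v,w\in V$: $|\langle Sv,Sw\rangle-\langle v,w\rangle|\le\epsilon\|v\|_2\|w\|_2$. The sparse JLT referred to is the known construction (Kane-Nelson) of an $(\epsilon,\delta,k)$-JLT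 $S\in\mathbb{R}^{d\times D}$ with $d=\mathcal{O}(\epsilon^{-2}\log(k\delta^{-1}))$ and $\mathcal{O}(\epsilon^{-1}\log(k\delta^{-1}))$ nonzero entries per column; its existence may be assumed. In the bound, the second argument of $\mathrm{SDP}$ is understood up to an absolute constant factor, i.e. it stands for the sketching dimension $d$ of this $S$. *)

theory Defs
  imports
    "HOL-Probability.Probability"
    "Jordan_Normal_Form.Matrix"
    "Jordan_Normal_Form.DL_Rank"
begin

text \<open>Matrices and vectors are those of \<open>Jordan_Normal_Form\<close>, because the sketching dimension,
  the ambient dimension and the number of constraints all vary inside the statement.\<close>

definition trace_mat :: "real mat \<Rightarrow> real" where
  "trace_mat M = (\<Sum>i<dim_row M. M $$ (i, i))"

definition sym_mat :: "nat \<Rightarrow> real mat \<Rightarrow> bool" where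
  "sym_mat n M \<longleftrightarrow> M \<in> carrier_mat n n \<and> transpose_mat M = M"

definition psd_mat :: "nat \<Rightarrow> real mat \<Rightarrow> bool" where
  "psd_mat n M \<longleftrightarrow> sym_mat n M \<and> (\<forall>v\<in>carrier_vec n. 0 \<le> scalar_prod v (M *\<^sub>v v))"

definition mat_sqrt :: "real mat \<Rightarrow> real mat" where
  "mat_sqrt M = (THE Q. psd_mat (dim_row M) Q \<and> Q * Q = M)"

definition schatten1 :: "real mat \<Rightarrow> real" where
  "schatten1 B = trace_mat (mat_sqrt (transpose_mat B * B))"

definition mat_rank :: "real mat \<Rightarrow> nat" where
  "mat_rank M = vec_space.rank (dim_row M) M"

definition nz_positions :: "real mat \<Rightarrow> (nat \<times> nat) set" where
  "nz_positions M = {(i, j). i < dim_row M \<and> j < dim_col M \<and> M $$ (i, j) \<noteq> 0}"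

definition nnz :: "real mat \<Rightarrow> nat" where
  "nnz M = card (nz_positions M)"

definition same_sparsity :: "real mat \<Rightarrow> real mat \<Rightarrow> bool" where
  "same_sparsity M N \<longleftrightarrow>
     dim_row M = dim_row N \<and> dim_col M = dim_col N \<and> nz_positions M = nz_positions N"


subsection \<open>Semidefinite programs\<close>

text \<open>\<open>SDP A [B\<^sub>1, \<dots>, B\<^sub>m] [\<gamma>\<^sub>1, \<dots>, \<gamma>\<^sub>m]\<close> stands for: maximize \<open>Tr (A X)\<close> subject to
  \<open>Tr (B\<^sub>i X) \<le> \<gamma>\<^sub>i\<close> and \<open>X \<ge> 0\<close>.\<close>

datatype sdp = SDP (objective: "real mat") (constraints: "real mat list") (bounds: "real list")

definition sketchable_sdp :: "nat \<Rightarrow> nat \<Rightarrow> sdp \<Rightarrow> bool" where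
  "sketchable_sdp m n P \<longleftrightarrow>
     sym_mat n (objective P) \<and> (\<forall>B\<in>set (constraints P). sym_mat n B) \<and>
     length (constraints P) = m \<and> length (bounds P) = m"

text \<open>The slack \<open>\<zeta>\<close> relaxes the linear constraints only; \<open>\<zeta> = 0\<close> is feasibility proper.\<close>

definition feasible_within :: "real \<Rightarrow> sdp \<Rightarrow> real mat \<Rightarrow> bool" where
  "feasible_within \<zeta> P X \<longleftrightarrow>
     psd_mat (dim_row (objective P)) X \<and>
     (\<forall>i<length (constraints P). trace_mat (constraints P ! i * X) \<le> bounds P ! i + \<zeta>)"

definition optimal_point :: "sdp \<Rightarrow> real mat \<Rightarrow> bool" where
  "optimal_point P X \<longleftrightarrow>
     feasible_within 0 P X \<and>
     (\<forall>Z. feasible_within 0 P Z \<longrightarrow> trace_mat (objective P * Z) \<le> trace_mat (objective P * X))"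

text \<open>A solution up to accuracy \<open>\<zeta>\<close> violates each linear constraint by at most \<open>\<zeta>\<close> and attains the
  optimal value up to an error of at most \<open>\<zeta>\<close>. The notion is used only where an optimal point
  exists.\<close>

definition solution_up_to :: "real \<Rightarrow> sdp \<Rightarrow> real mat \<Rightarrow> bool" where
  "solution_up_to \<zeta> P Y \<longleftrightarrow>
     feasible_within \<zeta> P Y \<and>
     (\<forall>X. optimal_point P X \<longrightarrow>
        \<bar>trace_mat (objective P * Y) - trace_mat (objective P * X)\<bar> \<le> \<zeta>)"

text \<open>The assumption that the relevant Schatten norms are \<open>O(1)\<close>, with an explicit bound \<open>R\<close>.
  It includes the objective matrix: if that could be scaled arbitrarily, no bounded number of
  operations would achieve an additive error \<open>\<zeta>\<close>, and the complexity below would be infinite.\<close>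

definition norms_bounded :: "real \<Rightarrow> sdp \<Rightarrow> bool" where
  "norms_bounded R P \<longleftrightarrow>
     schatten1 (objective P) \<le> R \<and> (\<forall>B\<in>set (constraints P). schatten1 B \<le> R) \<and>
     (\<exists>X. optimal_point P X \<and> schatten1 X \<le> R)"

text \<open>In the sketched SDP, \<open>\<beta>\<close> lists the available values for \<open>\<parallel>B\<^sub>i\<parallel>\<^sub>1\<close>: the norms themselves, or upper
  bounds on them, which are inputs and are not computed.\<close>

definition sketched_sdp :: "real \<Rightarrow> real \<Rightarrow> real list \<Rightarrow> real mat \<Rightarrow> sdp \<Rightarrow> sdp" where
  "sketched_sdp \<epsilon> \<eta> \<beta> S P =
     SDP (S * objective P * transpose_mat S)
         (map (\<lambda>B. S * B * transpose_mat S) (constraints P))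
         (map2 (\<lambda>g b. g + 3 * \<epsilon> * \<eta> * b) (bounds P) \<beta>)"


subsection \<open>Counting operations\<close>

text \<open>Algebraic computation trees. The registers initially hold the input; each \<open>Compute\<close> appends its
  result as a new register. Arithmetic operations and comparisons cost one unit each (free
  comparisons would allow free rounding); real constants, copying and index handling are free.
  Since \<open>x / 0 = 0\<close> in HOL, runs are total.\<close>

datatype arith = Add | Sub | Mul | Div

datatype operand = Const real | Reg nat

datatype program =
    Output "operand list"
  | Compute arith operand operand program
  | IfLe operand operand program program

fun arith_apply :: "arith \<Rightarrow> real \<Rightarrow> real \<Rightarrow> real" where
  "arith_apply Add x y = x + y"
| "arith_apply Sub x y = x - y"
| "arith_apply Mul x y = x * y"
| "arith_apply Div x y = x / y"

fun operand_val :: "real list \<Rightarrow> operand \<Rightarrow> real" where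
  "operand_val rs (Const c) = c"
| "operand_val rs (Reg i) = (if i < length rs then rs ! i else 0)"

fun run :: "program \<Rightarrow> real list \<Rightarrow> real list" where
  "run (Output as) rs = map (operand_val rs) as"
| "run (Compute f a b p) rs = run p (rs @ [arith_apply f (operand_val rs a) (operand_val rs b)])"
| "run (IfLe a b p q) rs = (if operand_val rs a \<le> operand_val rs b then run p rs else run q rs)"

text \<open>Worst-case number of operations over all inputs.\<close>

fun operations :: "program \<Rightarrow> nat" where
  "operations (Output as) = 0"
| "operations (Compute f a b p) = Suc (operations p)"
| "operations (IfLe a b p q) = Suc (max (operations p) (operations q))"

definition mat_entries :: "real mat \<Rightarrow> real list" where
  "mat_entries M = concat (mat_to_list M)"

definition sdp_entries :: "sdp \<Rightarrow> real list" where
  "sdp_entries P = mat_entries (objective P) @ concat (map mat_entries (constraints P)) @ bounds P"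

definition solves_sdps :: "real \<Rightarrow> nat \<Rightarrow> nat \<Rightarrow> real \<Rightarrow> program \<Rightarrow> bool" where
  "solves_sdps R m d \<zeta> p \<longleftrightarrow>
     (\<forall>Q. sketchable_sdp m d Q \<and> norms_bounded R Q \<longrightarrow>
        (\<exists>Y. run p (sdp_entries Q) = mat_entries Y \<and> solution_up_to \<zeta> Q Y))"

text \<open>\<open>SDP(m, d, \<zeta>)\<close>, for the norm bound \<open>R\<close>. The infimum is attained, unless no program qualifies, in
  which case it is \<open>\<infinity>\<close>.\<close>

definition sdp_complexity :: "real \<Rightarrow> nat \<Rightarrow> nat \<Rightarrow> real \<Rightarrow> enat" where
  "sdp_complexity R m d \<zeta> = (INF p\<in>{p. solves_sdps R m d \<zeta> p}. enat (operations p))"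

text \<open>Sparse matrices come with the positions of their nonzero entries, so a program may depend on
  these positions (and on the dimensions), but not on the values: it has to be correct for every
  SDP \<open>P'\<close> and every matrix \<open>S'\<close> with the same sparsity structure as \<open>P\<close> and \<open>S\<close>, whatever the
  \<open>\<gamma>\<^sub>i\<close>, \<open>\<eta>\<close> and \<open>\<beta>\<^sub>i\<close>. It outputs the sketched SDP, always, followed by an approximate solution of it
  whenever it is among the SDPs for which \<^const>\<open>sdp_complexity\<close> measures the cost of solving. No norm
  bound is imposed on \<open>P'\<close> itself.\<close>

definition generates_and_solves :: "real \<Rightarrow> real \<Rightarrow> real \<Rightarrow> sdp \<Rightarrow> real mat \<Rightarrow> program \<Rightarrow> bool" where
  "generates_and_solves R \<epsilon> \<zeta> P S p \<longleftrightarrow>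
     (\<forall>P' S' X' \<eta> \<beta>.
        sketchable_sdp (length (constraints P)) (dim_row (objective P)) P' \<and>
        same_sparsity (objective P) (objective P') \<and>
        list_all2 same_sparsity (constraints P) (constraints P') \<and>
        same_sparsity S S' \<and>
        optimal_point P' X' \<and> trace_mat X' \<le> \<eta> \<and>
        list_all2 (\<lambda>B b. schatten1 B \<le> b) (constraints P') \<beta> \<longrightarrow>
        (let Q = sketched_sdp \<epsilon> \<eta> \<beta> S' P' in
         \<exists>ys. run p (sdp_entries P' @ mat_entries S' @ \<beta> @ [\<eta>]) = sdp_entries Q @ ys \<and>
           (norms_bounded R Q \<longrightarrow> (\<exists>Y. ys = mat_entries Y \<and> solution_up_to \<zeta> Q Y))))"

definition sketching_complexity :: "real \<Rightarrow> real \<Rightarrow> real \<Rightarrow> sdp \<Rightarrow> real mat \<Rightarrow> enat" where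
  "sketching_complexity R \<epsilon> \<zeta> P S =
     (INF p\<in>{p. generates_and_solves R \<epsilon> \<zeta> P S p}. enat (operations p))"


subsection \<open>Sparse Johnson-Lindenstrauss transforms\<close>

definition vec_norm2 :: "real Matrix.vec \<Rightarrow> real" where
  "vec_norm2 v = sqrt (scalar_prod v v)"

definition is_JLT ::
  "'w measure \<Rightarrow> nat \<Rightarrow> nat \<Rightarrow> ('w \<Rightarrow> real mat) \<Rightarrow> real \<Rightarrow> real \<Rightarrow> nat \<Rightarrow> bool" where
  "is_JLT M d D S \<epsilon> \<delta> k \<longleftrightarrow>
     prob_space M \<and>
     (\<forall>\<omega>\<in>space M. S \<omega> \<in> carrier_mat d D) \<and>
     (\<forall>i<d. \<forall>j<D. (\<lambda>\<omega>. S \<omega> $$ (i, j)) \<in> borel_measurable M) \<and>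
     (\<forall>V \<subseteq> carrier_vec D. finite V \<and> card V = k \<longrightarrow>
        measure M {\<omega>\<in>space M. \<forall>v\<in>V. \<forall>w\<in>V.
          \<bar>scalar_prod (S \<omega> *\<^sub>v v) (S \<omega> *\<^sub>v w) - scalar_prod v w\<bar>
            \<le> \<epsilon> * vec_norm2 v * vec_norm2 w} \<ge> 1 - \<delta>)"

text \<open>\<open>c\<^sub>1\<close> and \<open>c\<^sub>2\<close> are the constants hidden in \<open>d = O(\<epsilon>\<^sup>-\<^sup>2 log (k/\<delta>))\<close> and in the \<open>O(\<epsilon>\<^sup>-\<^sup>1 log (k/\<delta>))\<close>
  nonzero entries per column. Both bounds leave room for at least one row and one nonzero entry
  per column; for \<open>\<epsilon> < 1\<close> (and \<open>k, D > 0\<close>, \<open>\<delta> < 1\<close>) this already follows from the other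
  conditions, since such a transform cannot vanish almost surely.\<close>

definition sparse_JLT ::
  "real \<Rightarrow> real \<Rightarrow> 'w measure \<Rightarrow> nat \<Rightarrow> nat \<Rightarrow> ('w \<Rightarrow> real mat) \<Rightarrow> real \<Rightarrow> real \<Rightarrow> nat \<Rightarrow> bool" where
  "sparse_JLT c\<^sub>1 c\<^sub>2 M d D S \<epsilon> \<delta> k \<longleftrightarrow>
     is_JLT M d D S \<epsilon> \<delta> k \<and>
     1 \<le> d \<and> real d \<le> c\<^sub>1 * (1 / \<epsilon>\<^sup>2) * ln (real k / \<delta>) \<and>
     1 \<le> c\<^sub>2 * (1 / \<epsilon>) * ln (real k / \<delta>) \<and>
     (\<forall>\<omega>\<in>space M. \<forall>j<D.
        real (card {i. (i, j) \<in> nz_positions (S \<omega>)}) \<le> c\<^sub>2 * (1 / \<epsilon>) * ln (real k / \<delta>))"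

end

theory Submission
  imports Defs
begin

text \<open>Multiply \<open>S B\<close> first, then \<open>(S B) S\<^sup>T\<close>. If every column of \<open>S\<close> has at most \<open>s\<close> nonzero entries,
  the first product consists of at most \<open>nnz(B) s\<close> elementary products, because each nonzero entry
  of \<open>B\<close> meets one column of \<open>S\<close>; the second one consists of at most \<open>d D s\<close>, because each of the
  \<open>d D\<close> entries of \<open>S B\<close> meets one column of \<open>S\<close>. An optimal solver is then run on the result, its
  register references being redirected.\<close>


subsection \<open>Straight-line computations\<close>

fun straight :: "(arith \<times> operand \<times> operand) list \<Rightarrow> program \<Rightarrow> program" where
  "straight [] p = p"
| "straight ((f, a, b) # sl) p = Compute f a b (straight sl p)"

fun exec :: "(arith \<times> operand \<times> operand) list \<Rightarrow> real list \<Rightarrow> real list" where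
  "exec [] rs = rs"
| "exec ((f, a, b) # sl) rs =
     exec sl (rs @ [arith_apply f (operand_val rs a) (operand_val rs b)])"

lemma run_straight: "run (straight sl p) rs = run p (exec sl rs)"
  by (induction sl p arbitrary: rs rule: straight.induct) auto

lemma operations_straight: "operations (straight sl p) = length sl + operations p"
  by (induction sl p rule: straight.induct) auto

lemma length_exec: "length (exec sl rs) = length rs + length sl"
  by (induction sl rs rule: exec.induct) auto

lemma exec_append: "exec (sl @ sl') rs = exec sl' (exec sl rs)"
  by (induction sl rs rule: exec.induct) auto

text \<open>A quantity is a real function of a problem instance \<open>x \<in> I\<close>, and \<open>fs\<close> lists the quantities
  that form the input. Quantifying over all later registers \<open>rs\<close> makes availability persistent.\<close>

definition available ::
  "'x set \<Rightarrow> ('x \<Rightarrow> real) list \<Rightarrow> (arith \<times> operand \<times> operand) list \<Rightarrow> ('x \<Rightarrow> real) \<Rightarrow> bool" where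
  "available I fs sl g \<longleftrightarrow>
     (\<exists>a. \<forall>x\<in>I. \<forall>rs. operand_val (exec sl (map (\<lambda>f. f x) fs) @ rs) a = g x)"

text \<open>One instruction list serves all of \<open>G\<close>, so intermediate results are shared.
  The operand that holds a quantity does not depend on the instance \<open>x\<close>, which makes
  the program uniform over \<open>I\<close>.\<close>

definition computable ::
  "'x set \<Rightarrow> ('x \<Rightarrow> real) list \<Rightarrow> nat \<Rightarrow> ('x \<Rightarrow> real) set \<Rightarrow> bool" where
  "computable I fs c G \<longleftrightarrow> (\<exists>sl. length sl \<le> c \<and> (\<forall>g\<in>G. available I fs sl g))"

lemma available_const: "available I fs sl (\<lambda>x. r)"
  unfolding available_def by (rule exI[of _ "Const r"]) simp

lemma available_input: "f \<in> set fs \<Longrightarrow> available I fs [] f"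
  unfolding available_def
  by (metis exec.simps(1) in_set_conv_nth length_append length_map nth_append nth_map
      operand_val.simps(2) trans_less_add1)

text \<open>The register appended by the new instruction is absorbed into the arbitrary tail
  \<open>rs\<close>.\<close>

lemma available_snoc:
  assumes "available I fs sl g"
  shows "available I fs (sl @ [(f, a, b)]) g"
  using assms unfolding available_def exec_append by fastforce

lemma computable_input: "computable I fs 0 (set fs)"
  unfolding computable_def using available_input by fastforce

text \<open>Equality is asked for on \<open>I\<close> only: for instances of the wrong shape, an
  entry of a product and the sum computing it may differ. The lemma also serves to discard
  intermediate results and to enlarge the budget.\<close>

lemma computable_cong:
  assumes "computable I fs c G"
    and "\<And>h. h \<in> H \<Longrightarrow> \<exists>g\<in>G. \<forall>x\<in>I. g x = h x"
    and "c \<le> c'"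
  shows "computable I fs c' H"
proof -
  obtain sl where sl: "length sl \<le> c" "\<forall>g\<in>G. available I fs sl g"
    using assms(1) by (auto simp: computable_def)
  have "available I fs sl h" if h: "h \<in> H" for h
  proof -
    obtain g where "g \<in> G" "\<forall>x\<in>I. g x = h x" using assms(2)[OF h] by blast
    then show ?thesis using sl(2) unfolding available_def by metis
  qed
  moreover have "length sl \<le> c'" using sl(1) assms(3) by simp
  ultimately show ?thesis unfolding computable_def by blast
qed

section \<open>Closure of the computable quantities under operations, sums and families\<close>

lemma computable_const:
  assumes "computable I fs c G"
  shows "computable I fs c (insert (\<lambda>x. r) G)"
  using assms available_const unfolding computable_def by blast

lemma computable_arith:
  assumes "computable I fs c G" "g \<in> G" "h \<in> G"
  shows "computable I fs (Suc c) (insert (\<lambda>x. arith_apply f (g x) (h x)) G)"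
proof -
  obtain sl where sl: "length sl \<le> c" "\<forall>g\<in>G. available I fs sl g"
    using assms(1) by (auto simp: computable_def)
  obtain a where a: "\<And>x rs. x \<in> I \<Longrightarrow> operand_val (exec sl (map (\<lambda>f. f x) fs) @ rs) a = g x"
    using sl(2) assms(2) unfolding available_def by blast
  obtain b where b: "\<And>x rs. x \<in> I \<Longrightarrow> operand_val (exec sl (map (\<lambda>f. f x) fs) @ rs) b = h x"
    using sl(2) assms(3) unfolding available_def by blast
  \<comment> \<open>Every instruction appends exactly one register, so the new value sits at index
    \<open>length fs + length sl\<close>. Both operands are read just before that, hence the empty
    tail in \<open>a\<close> and \<open>b\<close>.\<close>
  have "available I fs (sl @ [(f, a, b)]) (\<lambda>x. arith_apply f (g x) (h x))"
    unfolding available_def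
    using a[where rs = "[]"] b[where rs = "[]"]
    by (intro exI[of _ "Reg (length fs + length sl)"])
       (simp add: exec_append length_exec nth_append)
  moreover have "\<forall>g\<in>G. available I fs (sl @ [(f, a, b)]) g"
    using sl(2) available_snoc by blast
  ultimately show ?thesis
    using sl(1) unfolding computable_def by (intro exI[of _ "sl @ [(f, a, b)]"]) simp
qed

text \<open>Each term costs one multiplication and one addition; the empty sum is the constant 0,
  which is free.\<close>

lemma computable_sum_mult:
  assumes "finite T" "computable I fs c G" "\<And>t. t \<in> T \<Longrightarrow> f t \<in> G \<and> g t \<in> G"
  shows "computable I fs (c + 2 * card T) (insert (\<lambda>x. \<Sum>t\<in>T. f t x * g t x) G)"
  using assms(1,3)
proof (induction T)
  case empty
  then show ?case using computable_const[OF assms(2)] by simp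
next
  case (insert t T)
  let ?s = "\<lambda>x. \<Sum>t\<in>T. f t x * g t x" and ?p = "\<lambda>x. f t x * g t x"
  have "computable I fs (Suc (c + 2 * card T)) (insert ?p (insert ?s G))"
    using computable_arith[OF insert.IH, of "f t" "g t" Mul] insert.prems by auto
  from computable_arith[OF this, of ?p ?s Add]
  have "computable I fs (c + 2 * card (insert t T))
          (insert (\<lambda>x. f t x * g t x + ?s x) (insert ?p (insert ?s G)))"
    using insert.hyps by simp
  then show ?case
    by (rule computable_cong) (use insert.hyps in auto)
qed

text \<open>The hypothesis ranges over all larger sets \<open>G'\<close> and all budgets
  \<open>c'\<close>, because each member of the family is added after earlier ones have enlarged
  both.\<close>

lemma computable_family:
  assumes "finite A" "computable I fs c G"
    and "\<And>a c' G'. a \<in> A \<Longrightarrow> G \<subseteq> G' \<Longrightarrow> computable I fs c' G' \<Longrightarrow>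
           computable I fs (c' + K a) (G' \<union> H a)"
  shows "computable I fs (c + (\<Sum>a\<in>A. K a)) (G \<union> (\<Union>a\<in>A. H a))"
  using assms(1,3)
proof (induction A)
  case empty
  then show ?case using assms(2) by simp
next
  case (insert a A)
  have "computable I fs (c + (\<Sum>a\<in>A. K a) + K a) (G \<union> (\<Union>a\<in>A. H a) \<union> H a)"
    by (rule insert.prems) (use insert in auto)
  then show ?case using insert.hyps by (simp add: ac_simps)
qed


subsection \<open>Running a program on computed quantities\<close>

text \<open>There is no copy instruction, and copying by adding 0 would cost one operation per
  entry; rewriting the references is free. Here \<open>n\<close> is the number of registers in use
  when the relocated program starts.\<close>

fun redirect :: "operand list \<Rightarrow> nat \<Rightarrow> operand \<Rightarrow> operand" where
  "redirect as n (Const c) = Const c"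
| "redirect as n (Reg i) = (if i < length as then as ! i else Reg (n + (i - length as)))"

text \<open>Prefixing \<open>as\<close> to every output makes the program print its own input first.
  This is how the sketched SDP comes to precede its solution.\<close>

fun relocate :: "operand list \<Rightarrow> nat \<Rightarrow> program \<Rightarrow> program" where
  "relocate as n (Output bs) = Output (as @ map (redirect as n) bs)"
| "relocate as n (Compute f a b p) = Compute f (redirect as n a) (redirect as n b) (relocate as n p)"
| "relocate as n (IfLe a b p q) =
     IfLe (redirect as n a) (redirect as n b) (relocate as n p) (relocate as n q)"

lemma operations_relocate: "operations (relocate as n p) = operations p"
  by (induction p) auto

text \<open>\<open>vs\<close> is the input the original program expects, \<open>rs'\<close> what it
  has computed so far. The shift keeps out-of-range references out of range, so both sides then read
  the default 0.\<close>

lemma operand_val_redirect: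
  assumes "\<And>rs'. map (operand_val (rs @ rs')) as = vs"
  shows "operand_val (rs @ rs') (redirect as (length rs) a) = operand_val (vs @ rs') a"
proof (cases a)
  case (Reg i)
  have len: "length as = length vs" using assms by (metis length_map)
  have "i < length as \<Longrightarrow> operand_val (rs @ rs') (as ! i) = vs ! i"
    using assms[of rs'] by (metis nth_map)
  then show ?thesis using Reg len by (auto simp: nth_append)
qed simp

text \<open>The two runs proceed in lockstep: by the previous lemma they append the same values and
  take the same branches.\<close>

lemma run_relocate:
  assumes "\<And>rs'. map (operand_val (rs @ rs')) as = vs"
  shows "run (relocate as (length rs) p) (rs @ rs') = vs @ run p (vs @ rs')"
proof (induction p arbitrary: rs')
  case (Output bs)
  then show ?case using assms by (simp add: operand_val_redirect[OF assms])
next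
  case (Compute f a b p)
  show ?case by (simp add: operand_val_redirect[OF assms] Compute.IH)
next
  case (IfLe a b p q)
  then show ?case by (simp add: operand_val_redirect[OF assms])
qed

lemma computable_then_run:
  assumes "computable I fs c (set gs)"
  obtains q where "operations q \<le> c + operations p"
    "\<And>x. x \<in> I \<Longrightarrow> run q (map (\<lambda>f. f x) fs) =
       map (\<lambda>g. g x) gs @ run p (map (\<lambda>g. g x) gs)"
proof -
  obtain sl where sl: "length sl \<le> c" "\<forall>g\<in>set gs. available I fs sl g"
    using assms by (auto simp: computable_def)
  \<comment> \<open>The operands \<open>h g\<close> are fixed before \<open>x\<close>, so a single
    program serves every instance in \<open>I\<close>.\<close>
  then obtain h where h: "\<And>g x rs. g \<in> set gs \<Longrightarrow> x \<in> I \<Longrightarrow>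
      operand_val (exec sl (map (\<lambda>f. f x) fs) @ rs) (h g) = g x"
    unfolding available_def by metis
  let ?q = "straight sl (relocate (map h gs) (length fs + length sl) p)"
  show ?thesis
  proof
    show "operations ?q \<le> c + operations p"
      using sl(1) by (simp add: operations_straight operations_relocate)
    fix x assume "x \<in> I"
    then have "map (operand_val (exec sl (map (\<lambda>f. f x) fs) @ rs')) (map h gs) =
        map (\<lambda>g. g x) gs" for rs'
      using h by simp
    from run_relocate[OF this, of p "[]"]
    show "run ?q (map (\<lambda>f. f x) fs) = map (\<lambda>g. g x) gs @ run p (map (\<lambda>g. g x) gs)"
      by (simp add: run_straight length_exec)
  qed
qed


subsection \<open>Sparse matrix products\<close>

definition entries :: "nat \<Rightarrow> nat \<Rightarrow> ('x \<Rightarrow> real mat) \<Rightarrow> ('x \<Rightarrow> real) set" where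
  "entries r c A = (\<lambda>(i, j) x. A x $$ (i, j)) ` ({..<r} \<times> {..<c})"

text \<open>\<open>T i l\<close> contains the inner indices whose term may be nonzero. It is the
  same for all instances, so one instruction list skips the vanishing terms for all of them.\<close>

lemma computable_mult_sparse:
  assumes "computable I fs b G" "entries n r A \<subseteq> G" "entries r c B \<subseteq> G"
    and A: "\<And>x. x \<in> I \<Longrightarrow> A x \<in> carrier_mat n r"
    and B: "\<And>x. x \<in> I \<Longrightarrow> B x \<in> carrier_mat r c"
    and sub: "\<And>i l. T i l \<subseteq> {..<r}"
    and zero: "\<And>x i j l. x \<in> I \<Longrightarrow> i < n \<Longrightarrow> l < c \<Longrightarrow> j < r \<Longrightarrow> j \<notin> T i l \<Longrightarrow>
        A x $$ (i, j) * B x $$ (j, l) = 0"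
  shows "computable I fs (b + 2 * (\<Sum>(i, l)\<in>{..<n} \<times> {..<c}. card (T i l)))
           (G \<union> entries n c (\<lambda>x. A x * B x))"
proof -
  let ?P = "{..<n} \<times> {..<c}"
  let ?h = "\<lambda>(i, l) x. \<Sum>j\<in>T i l. A x $$ (i, j) * B x $$ (j, l)"
  have fin: "finite (T i l)" for i l using sub finite_subset by blast
  have "computable I fs (b + (\<Sum>a\<in>?P. 2 * (case a of (i, l) \<Rightarrow> card (T i l))))
      (G \<union> (\<Union>a\<in>?P. {?h a}))"
  proof (rule computable_family)
    fix a c' G' assume a: "a \<in> ?P" "G \<subseteq> G'" "computable I fs c' G'"
    obtain i l where il: "a = (i, l)" "i < n" "l < c" using a(1) by auto
    have "(\<lambda>x. A x $$ (i, j)) \<in> G' \<and> (\<lambda>x. B x $$ (j, l)) \<in> G'" if "j \<in> T i l" for j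
    proof -
      have "j < r" using that sub by blast
      then have "(\<lambda>x. A x $$ (i, j)) \<in> entries n r A" "(\<lambda>x. B x $$ (j, l)) \<in> entries r c B"
        using il by (auto simp: entries_def)
      then show ?thesis using assms(2,3) a(2) by blast
    qed
    from computable_sum_mult[OF fin a(3) this]
    show "computable I fs (c' + 2 * (case a of (i, l) \<Rightarrow> card (T i l))) (G' \<union> {?h a})"
      by (simp add: il)
  qed (use assms(1) in auto)
  then show ?thesis
  proof (rule computable_cong)
    fix h assume h: "h \<in> G \<union> entries n c (\<lambda>x. A x * B x)"
    show "\<exists>g\<in>G \<union> (\<Union>a\<in>?P. {?h a}). \<forall>x\<in>I. g x = h x"
    proof (cases "h \<in> G")
      case False
      then obtain i l where il: "i < n" "l < c" "h = (\<lambda>x. (A x * B x) $$ (i, l))"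
        using h by (auto simp: entries_def)
      have "?h (i, l) x = h x" if "x \<in> I" for x
      proof -
        have "h x = (\<Sum>j<r. A x $$ (i, j) * B x $$ (j, l))"
          using A[OF that] B[OF that] il by (auto simp: scalar_prod_def atLeast0LessThan)
        also have "\<dots> = ?h (i, l) x"
          using sub zero[OF that] il by (auto intro!: sum.mono_neutral_right)
        finally show ?thesis by simp
      qed
      then show ?thesis using il by (intro bexI[of _ "?h (i, l)"]) auto
    qed auto
  qed (simp add: sum_distrib_left)
qed

text \<open>\<open>2 * s * z\<close> pays for \<open>S x * B x\<close> and
  \<open>2 * s * (d * n)\<close> for the multiplication by the transpose; the factor 2 counts a
  multiplication and an addition per term.\<close>

lemma computable_congruence_sparse:
  assumes "computable I fs b G" "entries d n S \<subseteq> G" "entries n n B \<subseteq> G"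
    and S: "\<And>x. x \<in> I \<Longrightarrow> S x \<in> carrier_mat d n \<and> nz_positions (S x) = W"
    and B: "\<And>x. x \<in> I \<Longrightarrow> B x \<in> carrier_mat n n \<and> nz_positions (B x) = Z"
    and Z: "Z \<subseteq> {..<n} \<times> {..<n}" "card Z \<le> z"
    and W: "W \<subseteq> {..<d} \<times> {..<n}" "\<And>j. j < n \<Longrightarrow> card {i. (i, j) \<in> W} \<le> s"
  shows "computable I fs (b + 2 * s * (z + d * n))
           (G \<union> entries d d (\<lambda>x. S x * B x * transpose_mat (S x)))"
proof -
  have finZ: "finite Z" using Z(1) finite_subset by blast
  have fincol: "finite {i. (i, j) \<in> W}" for j
    by (rule finite_subset[of _ "{..<d}"]) (use W(1) in auto)
  define T where "T i l = {j. (i, j) \<in> W \<and> (j, l) \<in> Z}" for i l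
  \<comment> \<open>There is no dependence on \<open>i\<close>, since the intermediate product is
    treated as dense.\<close>
  define U where "U i k = {l. (k, l) \<in> W}" for i k :: nat
  have finT: "finite (T i l)" for i l
    by (rule finite_subset[of _ "{..<n}"]) (use Z(1) in \<open>auto simp: T_def\<close>)
  have finU: "finite (U i l)" for i l
    by (rule finite_subset[of _ "{..<n}"]) (use W(1) in \<open>auto simp: U_def\<close>)
  have SB: "computable I fs (b + 2 * (\<Sum>(i, l)\<in>{..<d} \<times> {..<n}. card (T i l)))
      (G \<union> entries d n (\<lambda>x. S x * B x))"
  proof (rule computable_mult_sparse[OF assms(1-3)])
    show "T i l \<subseteq> {..<n}" for i l using Z(1) by (auto simp: T_def)
    show "S x $$ (i, j) * B x $$ (j, l) = 0"
      if "x \<in> I" "i < d" "l < n" "j < n" "j \<notin> T i l" for x i j l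
    proof -
      have "(i, j) \<notin> nz_positions (S x) \<or> (j, l) \<notin> nz_positions (B x)"
        using that S B by (auto simp: T_def)
      then show ?thesis using that S[OF that(1)] B[OF that(1)] by (auto simp: nz_positions_def)
    qed
  qed (use S B in auto)
  have T: "(\<Sum>(i, l)\<in>{..<d} \<times> {..<n}. card (T i l)) \<le> z * s"
  proof -
    have "(\<Sum>(i, l)\<in>{..<d} \<times> {..<n}. card (T i l)) =
        card (SIGMA (i, l):{..<d} \<times> {..<n}. T i l)"
      using finT by (subst card_SigmaI) (auto simp: case_prod_beta intro!: sum.cong)
    \<comment> \<open>Double counting: grouping the triples by the entry \<open>(j, l)\<close> of
      \<open>Z\<close> leaves \<open>i\<close> ranging over column \<open>j\<close> of
      \<open>W\<close>.\<close>
    also have "\<dots> \<le> card (SIGMA (j, l):Z. {i. (i, j) \<in> W})"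
      using finZ fincol
      by (intro card_inj_on_le[of "\<lambda>((i, l), j). ((j, l), i)"])
         (auto simp: inj_on_def T_def split: prod.splits)
    also have "\<dots> = (\<Sum>(j, l)\<in>Z. card {i. (i, j) \<in> W})"
      using finZ fincol by (subst card_SigmaI) (auto simp: case_prod_beta intro!: sum.cong)
    also have "\<dots> \<le> (\<Sum>(j, l)\<in>Z. s)"
      using Z(1) W(2) by (intro sum_mono) auto
    also have "\<dots> \<le> z * s"
      using Z(2) by (simp add: case_prod_beta)
    finally show ?thesis .
  qed
  have "computable I fs (b + 2 * (\<Sum>(i, l)\<in>{..<d} \<times> {..<n}. card (T i l)) +
        2 * (\<Sum>(i, k)\<in>{..<d} \<times> {..<d}. card (U i k)))
      (G \<union> entries d n (\<lambda>x. S x * B x) \<union> entries n d (\<lambda>x. transpose_mat (S x))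
        \<union> entries d d (\<lambda>x. S x * B x * transpose_mat (S x)))"
  proof (rule computable_mult_sparse)
    \<comment> \<open>Transposition costs nothing: on \<open>I\<close>, each entry of the transpose
      is an entry of \<open>S x\<close>, which is already in \<open>G\<close>.\<close>
    show "computable I fs (b + 2 * (\<Sum>(i, l)\<in>{..<d} \<times> {..<n}. card (T i l)))
        (G \<union> entries d n (\<lambda>x. S x * B x) \<union> entries n d (\<lambda>x. transpose_mat (S x)))"
      using SB
    proof (rule computable_cong)
      fix h
      assume h: "h \<in> G \<union> entries d n (\<lambda>x. S x * B x) \<union> entries n d (\<lambda>x. transpose_mat (S x))"
      show "\<exists>g\<in>G \<union> entries d n (\<lambda>x. S x * B x). \<forall>x\<in>I. g x = h x"
      proof (cases "h \<in> entries n d (\<lambda>x. transpose_mat (S x))")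
        case True
        then obtain i j where ij: "i < n" "j < d" "h = (\<lambda>x. transpose_mat (S x) $$ (i, j))"
          by (auto simp: entries_def)
        then have "(\<lambda>x. S x $$ (j, i)) \<in> G" using assms(2) by (auto simp: entries_def)
        moreover have "S x $$ (j, i) = h x" if "x \<in> I" for x
          using S[OF that] ij by auto
        ultimately show ?thesis by (intro bexI[of _ "\<lambda>x. S x $$ (j, i)"]) auto
      qed (use h in auto)
    qed simp
    show "U i l \<subseteq> {..<n}" for i l using W(1) by (auto simp: U_def)
    show "S x * B x \<in> carrier_mat d n" if "x \<in> I" for x
      using S[OF that] B[OF that] mult_carrier_mat by blast
    show "(S x * B x) $$ (i, j) * transpose_mat (S x) $$ (j, l) = 0"
      if "x \<in> I" "i < d" "l < d" "j < n" "j \<notin> U i l" for x i j l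
    proof -
      have "(l, j) \<notin> nz_positions (S x)" using that S by (auto simp: U_def)
      then show ?thesis using that S[OF that(1)] by (auto simp: nz_positions_def)
    qed
  qed (use S B in auto)
  moreover have "(\<Sum>(i, k)\<in>{..<d} \<times> {..<d}. card (U i k)) \<le> d * (n * s)"
  proof -
    \<comment> \<open>The bound \<open>s\<close> concerns columns, whereas \<open>U i k\<close> is a
      row of \<open>W\<close>. Summed over all rows these counts give the size of \<open>W\<close>,
      which is then counted by columns.\<close>
    have "(\<Sum>k<d. card (U i k)) \<le> n * s" for i
    proof -
      have "(\<Sum>k<d. card (U i k)) = card (SIGMA k:{..<d}. U i k)"
        using finU by (subst card_SigmaI) auto
      also have "\<dots> \<le> card (SIGMA l:{..<n}. {k. (k, l) \<in> W})"
        using fincol W(1)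
        by (intro card_inj_on_le[of "\<lambda>(k, l). (l, k)"]) (auto simp: inj_on_def U_def)
      also have "\<dots> = (\<Sum>l<n. card {k. (k, l) \<in> W})"
        using fincol by (subst card_SigmaI) auto
      also have "\<dots> \<le> (\<Sum>l<n. s)" using W(2) by (intro sum_mono) auto
      finally show ?thesis by simp
    qed
    then have "(\<Sum>i<d. \<Sum>k<d. card (U i k)) \<le> (\<Sum>i<d. n * s)" by (intro sum_mono)
    then show ?thesis by (simp add: sum.cartesian_product)
  qed
  ultimately show ?thesis
    using T by (elim computable_cong) (auto simp: algebra_simps)
qed


subsection \<open>Generating and solving the sketched program\<close>

definition mat_quantities :: "nat \<Rightarrow> nat \<Rightarrow> ('x \<Rightarrow> real mat) \<Rightarrow> ('x \<Rightarrow> real) list" where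
  "mat_quantities r c A = concat (map (\<lambda>i. map (\<lambda>j x. A x $$ (i, j)) [0..<c]) [0..<r])"

definition sdp_quantities :: "nat \<Rightarrow> nat \<Rightarrow> ('x \<Rightarrow> sdp) \<Rightarrow> ('x \<Rightarrow> real) list" where
  "sdp_quantities m n P =
     mat_quantities n n (\<lambda>x. objective (P x)) @
     concat (map (\<lambda>i. mat_quantities n n (\<lambda>x. constraints (P x) ! i)) [0..<m]) @
     map (\<lambda>i x. bounds (P x) ! i) [0..<m]"

lemma set_mat_quantities: "set (mat_quantities r c A) = entries r c A"
  by (auto simp: mat_quantities_def entries_def)

lemma map_mat_quantities:
  assumes "A x \<in> carrier_mat r c"
  shows "map (\<lambda>f. f x) (mat_quantities r c A) = mat_entries (A x)"
  using assms by (auto simp: mat_quantities_def mat_entries_def mat_to_list_def map_concat comp_def)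

lemma map_sdp_quantities:
  assumes "sketchable_sdp m n (P x)"
  shows "map (\<lambda>f. f x) (sdp_quantities m n P) = sdp_entries (P x)"
proof -
  have len: "length (constraints (P x)) = m" "length (bounds (P x)) = m"
    and carr: "objective (P x) \<in> carrier_mat n n"
      "\<And>i. i < m \<Longrightarrow> constraints (P x) ! i \<in> carrier_mat n n"
    using assms by (auto simp: sketchable_sdp_def sym_mat_def)
  have "map (\<lambda>i. map (\<lambda>f. f x) (mat_quantities n n (\<lambda>x. constraints (P x) ! i))) [0..<m] =
      map (\<lambda>i. mat_entries (constraints (P x) ! i)) [0..<m]"
    using carr by (intro map_cong) (auto simp: map_mat_quantities)
  also have "\<dots> = map mat_entries (constraints (P x))"
    using len by (auto intro: nth_equalityI)
  finally have "map (\<lambda>i. map (\<lambda>f. f x) (mat_quantities n n (\<lambda>x. constraints (P x) ! i))) [0..<m] =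
      map mat_entries (constraints (P x))" .
  moreover have "map (\<lambda>i. bounds (P x) ! i) [0..<m] = bounds (P x)"
    using len by (auto intro: nth_equalityI)
  ultimately show ?thesis
    using carr(1)
    by (simp add: sdp_quantities_def sdp_entries_def map_mat_quantities map_concat comp_def)
qed

text \<open>Solvers are guaranteed only for symmetric data; congruence preserves symmetry.\<close>

lemma sketchable_sketched_sdp:
  assumes "sketchable_sdp m n P" "S \<in> carrier_mat d n" "length \<beta> = m"
  shows "sketchable_sdp m d (sketched_sdp \<epsilon> \<eta> \<beta> S P)"
proof -
  have "sym_mat d (S * B * transpose_mat S)" if "sym_mat n B" for B
  proof -
    have B: "B \<in> carrier_mat n n" "transpose_mat B = B" using that by (auto simp: sym_mat_def)
    have "transpose_mat (S * B * transpose_mat S) = S * transpose_mat (S * B)"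
      using transpose_mult[of "S * B" d n "transpose_mat S" d] assms(2) B(1) by simp
    also have "transpose_mat (S * B) = B * transpose_mat S"
      using transpose_mult[of S d n B n] assms(2) B by simp
    also have "S * (B * transpose_mat S) = S * B * transpose_mat S"
      using assoc_mult_mat[of S d n B n "transpose_mat S" d] assms(2) B(1) by simp
    finally show ?thesis using assms(2) B(1) by (auto simp: sym_mat_def)
  qed
  then show ?thesis using assms by (auto simp: sketchable_sdp_def sketched_sdp_def)
qed

text \<open>Two multiplications and one addition; the constant \<open>r\<close>, later
  \<open>3 * \<epsilon>\<close>, is free.\<close>

lemma computable_slack:
  assumes "computable I fs c G" "g \<in> G" "\<eta> \<in> G" "b \<in> G"
  shows "computable I fs (c + 3) (G \<union> {\<lambda>x. g x + r * \<eta> x * b x})"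
proof -
  let ?u = "\<lambda>x. r * \<eta> x" and ?v = "\<lambda>x. r * \<eta> x * b x"
  have "computable I fs (Suc c) (insert ?u (insert (\<lambda>x. r) G))"
    using computable_arith[OF computable_const[OF assms(1), of r], of "\<lambda>x. r" \<eta> Mul] assms(3)
    by simp
  from computable_arith[OF this, of ?u b Mul]
  have "computable I fs (Suc (Suc c)) (insert ?v (insert ?u (insert (\<lambda>x. r) G)))"
    using assms(4) by simp
  from computable_arith[OF this, of g ?v Add]
  have "computable I fs (c + 3)
      (insert (\<lambda>x. g x + ?v x) (insert ?v (insert ?u (insert (\<lambda>x. r) G))))"
    using assms(2) by (simp add: numeral_3_eq_3)
  then show ?thesis by (rule computable_cong) auto
qed

text \<open>There are \<open>m + 1\<close> congruences, one for the objective and one per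
  constraint, and three operations per relaxed bound.\<close>

lemma computable_sketched_sdp:
  fixes P :: "'x \<Rightarrow> sdp"
  assumes I: "\<And>x. x \<in> I \<Longrightarrow> sketchable_sdp m n (P x)" "\<And>x. x \<in> I \<Longrightarrow> length (\<beta> x) = m"
    and S: "\<And>x. x \<in> I \<Longrightarrow> S x \<in> carrier_mat d n \<and> nz_positions (S x) = W"
    and Z: "\<And>x. x \<in> I \<Longrightarrow> nz_positions (objective (P x)) = Z" "card Z \<le> z"
      "\<And>x i. x \<in> I \<Longrightarrow> i < m \<Longrightarrow> nz_positions (constraints (P x) ! i) = Z' i"
      "\<And>i. i < m \<Longrightarrow> card (Z' i) \<le> z"
    and W: "\<And>j. j < n \<Longrightarrow> card {i. (i, j) \<in> W} \<le> s"
    and G: "computable I fs b G" "set (sdp_quantities m n P) \<subseteq> G" "entries d n S \<subseteq> G" "\<eta> \<in> G"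
      "\<And>i. i < m \<Longrightarrow> (\<lambda>x. \<beta> x ! i) \<in> G"
  shows "computable I fs (b + (m + 1) * (2 * s * (z + d * n)) + 3 * m)
           (set (sdp_quantities m d (\<lambda>x. sketched_sdp \<epsilon> (\<eta> x) (\<beta> x) (S x) (P x))))"
\<comment> \<open>An instance \<open>x0\<close> is needed to see that \<open>W\<close>,
  \<open>Z\<close> and \<open>Z'\<close> lie within the index ranges. Without instances every
  quantity matches vacuously, and the inserted constant merely supplies something to match.\<close>
proof (cases "I = {}")
  case True
  then show ?thesis
    by (intro computable_cong[OF computable_const[OF G(1), of 0]]) auto
next
  case False
  then obtain x0 where x0: "x0 \<in> I" by blast
  let ?K = "2 * s * (z + d * n)"
  have carr: "objective (P x) \<in> carrier_mat n n" if "x \<in> I" for x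
    using I(1)[OF that] by (auto simp: sketchable_sdp_def sym_mat_def)
  have carrB: "constraints (P x) ! i \<in> carrier_mat n n" if "x \<in> I" "i < m" for x i
    using I(1)[OF that(1)] that(2) by (auto simp: sketchable_sdp_def sym_mat_def)
  have pos: "nz_positions M \<subseteq> {..<r} \<times> {..<c}" if "M \<in> carrier_mat r c" for M r c
    using that by (auto simp: nz_positions_def)
  have posZ: "Z \<subseteq> {..<n} \<times> {..<n}" using pos[OF carr[OF x0]] Z(1)[OF x0] by simp
  have posZ': "Z' i \<subseteq> {..<n} \<times> {..<n}" if "i < m" for i
    using pos[OF carrB[OF x0 that]] Z(3)[OF x0 that] by simp
  have posW: "W \<subseteq> {..<d} \<times> {..<n}" using pos S[OF x0] by blast
  have in_objective: "entries n n (\<lambda>x. objective (P x)) \<subseteq> G"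
    and in_constraints: "\<And>i. i < m \<Longrightarrow> entries n n (\<lambda>x. constraints (P x) ! i) \<subseteq> G"
    and in_bounds: "\<And>i. i < m \<Longrightarrow> (\<lambda>x. bounds (P x) ! i) \<in> G"
    using G(2) by (force simp: sdp_quantities_def set_mat_quantities)+
  let ?O = "entries d d (\<lambda>x. S x * objective (P x) * transpose_mat (S x))"
  let ?C = "\<lambda>i. entries d d (\<lambda>x. S x * (constraints (P x) ! i) * transpose_mat (S x))"
  let ?g = "\<lambda>i x. bounds (P x) ! i + 3 * \<epsilon> * \<eta> x * \<beta> x ! i"
  have "computable I fs (b + ?K) (G \<union> ?O)"
    by (rule computable_congruence_sparse[OF G(1,3) in_objective S _ posZ Z(2) posW W])
       (use carr Z(1) in auto)
  then have "computable I fs (b + ?K + (\<Sum>i<m. ?K)) (G \<union> ?O \<union> (\<Union>i<m. ?C i))"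
  proof (rule computable_family[OF finite_lessThan])
    fix i c' G' assume i: "i \<in> {..<m}" "G \<union> ?O \<subseteq> G'" "computable I fs c' G'"
    have im: "i < m" using i(1) by simp
    have "entries d n S \<subseteq> G'" "entries n n (\<lambda>x. constraints (P x) ! i) \<subseteq> G'"
      using G(3) in_constraints[OF im] i(2) by blast+
    from computable_congruence_sparse[OF i(3) this S _ posZ'[OF im] Z(4)[OF im] posW W]
    show "computable I fs (c' + ?K) (G' \<union> ?C i)"
      using carrB Z(3) im by blast
  qed
  then have "computable I fs (b + ?K + (\<Sum>i<m. ?K) + (\<Sum>i<m. 3))
      (G \<union> ?O \<union> (\<Union>i<m. ?C i) \<union> (\<Union>i<m. {?g i}))"
  proof (rule computable_family[OF finite_lessThan])
    fix i c' G' assume "i \<in> {..<m}" "G \<union> ?O \<union> (\<Union>i<m. ?C i) \<subseteq> G'" "computable I fs c' G'"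
    then show "computable I fs (c' + 3) (G' \<union> {?g i})"
      using in_bounds G(4,5) by (intro computable_slack) auto
  qed
  then show ?thesis
  proof (rule computable_cong)
    let ?Q = "\<lambda>x. sketched_sdp \<epsilon> (\<eta> x) (\<beta> x) (S x) (P x)"
    let ?all = "G \<union> ?O \<union> (\<Union>i<m. ?C i) \<union> (\<Union>i<m. {?g i})"
    fix h assume "h \<in> set (sdp_quantities m d ?Q)"
    then consider "h \<in> entries d d (\<lambda>x. objective (?Q x))"
      | i where "i < m" "h \<in> entries d d (\<lambda>x. constraints (?Q x) ! i)"
      | i where "i < m" "h = (\<lambda>x. bounds (?Q x) ! i)"
      by (auto simp: sdp_quantities_def set_mat_quantities)
    then show "\<exists>g\<in>?all. \<forall>x\<in>I. g x = h x"
    proof cases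
      case 1
      then show ?thesis by (intro bexI[of _ h]) (auto simp: sketched_sdp_def)
    next
      case 2
      then obtain j k where jk: "j < d" "k < d" "h = (\<lambda>x. constraints (?Q x) ! i $$ (j, k))"
        by (auto simp: entries_def)
      let ?f = "\<lambda>x. (S x * (constraints (P x) ! i) * transpose_mat (S x)) $$ (j, k)"
      have "?f \<in> ?C i" using jk by (auto simp: entries_def)
      then have "?f \<in> ?all" using 2 by blast
      moreover have "\<forall>x\<in>I. ?f x = h x"
        using I(1) 2(1) by (auto simp: jk sketched_sdp_def sketchable_sdp_def)
      ultimately show ?thesis by (intro bexI[of _ ?f])
    next
      case 3
      have "\<forall>x\<in>I. ?g i x = h x"
        using I 3(1) by (auto simp: 3(2) sketched_sdp_def sketchable_sdp_def)
      moreover have "?g i \<in> ?all" using 3(1) by auto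
      ultimately show ?thesis by (intro bexI[of _ "?g i"])
    qed
  qed simp
qed

text \<open>The bound without hidden constants: the solver is attached to the generating
  instructions at its exact cost.\<close>

lemma sketching_complexity_le:
  assumes P: "sketchable_sdp m n P" and S: "S \<in> carrier_mat d n"
    and z: "\<And>B. B \<in> set (objective P # constraints P) \<Longrightarrow> nnz B \<le> z"
    and s: "\<And>j. j < n \<Longrightarrow> card {i. (i, j) \<in> nz_positions S} \<le> s"
  shows "sketching_complexity R \<epsilon> \<zeta> P S \<le>
           enat ((m + 1) * (2 * s * (z + d * n)) + 3 * m) + sdp_complexity R m d \<zeta>"
proof (cases "sdp_complexity R m d \<zeta>")
  case infinity
  then show ?thesis by simp
next
  case (enat N)
  let ?sols = "{p. solves_sdps R m d \<zeta> p}"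
  \<comment> \<open>A finite infimum excludes the empty set, and \<open>enat\<close> is
    well-ordered, so the infimum is attained by some solver \<open>p\<close>.\<close>
  have "(\<lambda>p. enat (operations p)) ` ?sols \<noteq> {}" (is "?A \<noteq> {}")
  proof
    assume "?A = {}"
    then have "sdp_complexity R m d \<zeta> = \<infinity>"
      unfolding sdp_complexity_def Inf_enat_def by (rule if_P)
    then show False using enat by simp
  qed
  then obtain k where "k \<in> ?A" by blast
  then have "sdp_complexity R m d \<zeta> \<in> ?A"
    unfolding sdp_complexity_def by (rule wellorder_InfI)
  then obtain p where p: "solves_sdps R m d \<zeta> p" "operations p = N"
    using enat by auto
  let ?Pr = "\<lambda>x :: sdp \<times> real mat \<times> real list \<times> real. fst x"
  let ?Sr = "\<lambda>x :: sdp \<times> real mat \<times> real list \<times> real. fst (snd x)"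
  let ?\<beta> = "\<lambda>x :: sdp \<times> real mat \<times> real list \<times> real. fst (snd (snd x))"
  let ?\<eta> = "\<lambda>x :: sdp \<times> real mat \<times> real list \<times> real. snd (snd (snd x))"
  define I where "I = {x. sketchable_sdp m n (?Pr x) \<and>
      same_sparsity (objective P) (objective (?Pr x)) \<and>
      list_all2 same_sparsity (constraints P) (constraints (?Pr x)) \<and>
      same_sparsity S (?Sr x) \<and> length (?\<beta> x) = m}"
  \<comment> \<open>The order must agree with the input layout in
    \<open>generates_and_solves\<close>.\<close>
  define fs where "fs = sdp_quantities m n ?Pr @ mat_quantities d n ?Sr @
      map (\<lambda>i x. ?\<beta> x ! i) [0..<m] @ [?\<eta>]"
  let ?Q = "\<lambda>x. sketched_sdp \<epsilon> (?\<eta> x) (?\<beta> x) (?Sr x) (?Pr x)"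
  have lenP: "length (constraints P) = m" using P by (simp add: sketchable_sdp_def)
  have dimS: "dim_row S = d" "dim_col S = n" using S by auto
  have Sr: "?Sr x \<in> carrier_mat d n \<and> nz_positions (?Sr x) = nz_positions S" if "x \<in> I" for x
    using that dimS by (auto simp: I_def same_sparsity_def)
  have "computable I fs (0 + (m + 1) * (2 * s * (z + d * n)) + 3 * m) (set (sdp_quantities m d ?Q))"
  proof (rule computable_sketched_sdp[OF _ _ Sr _ _ _ _ s computable_input,
        where Z = "nz_positions (objective P)" and Z' = "\<lambda>i. nz_positions (constraints P ! i)"])
    show "card (nz_positions (objective P)) \<le> z" using z[of "objective P"] by (simp add: nnz_def)
    show "card (nz_positions (constraints P ! i)) \<le> z" if "i < m" for i
      using z[of "constraints P ! i"] that lenP by (simp add: nnz_def)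
    show "nz_positions (constraints (?Pr x) ! i) = nz_positions (constraints P ! i)"
      if "x \<in> I" "i < m" for x i
      using that lenP by (auto simp: I_def list_all2_conv_all_nth same_sparsity_def)
  qed (auto simp: I_def same_sparsity_def fs_def set_mat_quantities)
  then obtain q where q: "operations q \<le> (m + 1) * (2 * s * (z + d * n)) + 3 * m + operations p"
    and run_q: "\<And>x. x \<in> I \<Longrightarrow> run q (map (\<lambda>f. f x) fs) =
      map (\<lambda>g. g x) (sdp_quantities m d ?Q) @ run p (map (\<lambda>g. g x) (sdp_quantities m d ?Q))"
    by (elim computable_then_run) auto
  have "generates_and_solves R \<epsilon> \<zeta> P S q"
    unfolding generates_and_solves_def Let_def
  proof (intro allI impI, elim conjE)
    fix P' S' X' \<eta> \<beta>
    assume H: "sketchable_sdp (length (constraints P)) (dim_row (objective P)) P'"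
      "same_sparsity (objective P) (objective P')"
      "list_all2 same_sparsity (constraints P) (constraints P')"
      "same_sparsity S S'" "list_all2 (\<lambda>B b. schatten1 B \<le> b) (constraints P') \<beta>"
    let ?x = "(P', S', \<beta>, \<eta>)" and ?R = "sketched_sdp \<epsilon> \<eta> \<beta> S' P'"
    have "dim_row (objective P) = n" using P by (auto simp: sketchable_sdp_def sym_mat_def)
    then have P': "sketchable_sdp m n P'" using H(1) lenP by simp
    then have len: "length \<beta> = m"
      using H(5) by (auto simp: sketchable_sdp_def dest: list_all2_lengthD)
    have x: "?x \<in> I" using H P' len by (simp add: I_def)
    have S': "S' \<in> carrier_mat d n" using Sr[OF x] by simp
    have R: "sketchable_sdp m d ?R" by (rule sketchable_sketched_sdp[OF P' S' len])
    have "map (\<lambda>i. \<beta> ! i) [0..<m] = \<beta>" using len by (auto intro: nth_equalityI)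
    then have fs: "map (\<lambda>f. f ?x) fs = sdp_entries P' @ mat_entries S' @ \<beta> @ [\<eta>]"
      using map_sdp_quantities[of m n ?Pr ?x] map_mat_quantities[of ?Sr ?x d n] P' S'
      by (simp add: fs_def comp_def)
    have gs: "map (\<lambda>g. g ?x) (sdp_quantities m d ?Q) = sdp_entries ?R"
      using map_sdp_quantities[of m d ?Q ?x] R by simp
    have "run q (sdp_entries P' @ mat_entries S' @ \<beta> @ [\<eta>]) =
        sdp_entries ?R @ run p (sdp_entries ?R)"
      using run_q[OF x] unfolding fs gs .
    \<comment> \<open>The witness is the output of \<open>p\<close> on the sketched SDP. The norm
      bound under which a solution is demanded is the one under which \<open>p\<close> guarantees
      it.\<close>
    then show "\<exists>ys. run q (sdp_entries P' @ mat_entries S' @ \<beta> @ [\<eta>]) = sdp_entries ?R @ ys \<and>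
        (norms_bounded R ?R \<longrightarrow> (\<exists>Y. ys = mat_entries Y \<and> solution_up_to \<zeta> ?R Y))"
      using p(1) R unfolding solves_sdps_def by blast
  qed
  then have "sketching_complexity R \<epsilon> \<zeta> P S \<le> enat (operations q)"
    unfolding sketching_complexity_def by (intro INF_lower) simp
  also have "\<dots> \<le> enat ((m + 1) * (2 * s * (z + d * n)) + 3 * m) + sdp_complexity R m d \<zeta>"
    using q p(2) enat by simp
  finally show ?thesis .
qed

section \<open>From the exact count to the asymptotic bound\<close>

lemma operation_count_le:
  fixes c\<^sub>1 c\<^sub>2 \<epsilon> L :: real
  assumes pos: "0 < \<epsilon>" "0 < L" and "1 \<le> m" "1 \<le> n" "1 \<le> d"
    and d: "real d \<le> c\<^sub>1 * (1 / \<epsilon>\<^sup>2) * L" and one: "1 \<le> c\<^sub>2 * (1 / \<epsilon>) * L"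
  shows "real ((m + 1) * (2 * nat \<lfloor>c\<^sub>2 * (1 / \<epsilon>) * L\<rfloor> * (z + d * n)) + 3 * m)
      \<le> (1 + \<bar>7 * c\<^sub>2 * (1 + c\<^sub>1)\<bar>) *
          (max (real z) (real n * (1 / \<epsilon>\<^sup>2) * L) * (1 / \<epsilon>) * real m * L)"
proof -
  define s where "s = nat \<lfloor>c\<^sub>2 * (1 / \<epsilon>) * L\<rfloor>"
  define E where "E = max (real z) (real n * (1 / \<epsilon>\<^sup>2) * L)"
  have s: "1 \<le> s" "real s \<le> c\<^sub>2 * (1 / \<epsilon>) * L" using one by (auto simp: s_def le_nat_iff)
  \<comment> \<open>The sign of \<open>c\<^sub>1\<close> is not given; it follows from
    \<open>1 \<le> d\<close> and is needed for monotonicity below.\<close>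
  have "0 < c\<^sub>1 * (1 / \<epsilon>\<^sup>2 * L)" using d assms(5) by (simp add: mult.assoc)
  moreover have "0 < 1 / \<epsilon>\<^sup>2 * L" using pos by simp
  ultimately have c1: "0 < c\<^sub>1" using zero_less_mult_pos2 by blast
  have E: "0 \<le> E" by (simp add: E_def)
  have "real d * real n \<le> c\<^sub>1 * (1 / \<epsilon>\<^sup>2) * L * real n" by (intro mult_right_mono d) simp
  also have "\<dots> = c\<^sub>1 * (real n * (1 / \<epsilon>\<^sup>2) * L)" by simp
  also have "\<dots> \<le> c\<^sub>1 * E" using c1 by (intro mult_left_mono) (auto simp: E_def)
  finally have zdn: "real (z + d * n) \<le> (1 + c\<^sub>1) * E" by (simp add: E_def algebra_simps)
  define K where "K = s * (z + d * n)"
  \<comment> \<open>This lets the \<open>3 * m\<close> operations for the bounds be absorbed into a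
    multiple of \<open>m * K\<close>.\<close>
  have "1 * 1 \<le> K"
    unfolding K_def using s(1) assms(4,5) by (intro mult_le_mono) (auto intro: trans_le_add2)
  \<comment> \<open>With \<open>m + 1 \<le> 2 * m\<close> the congruences contribute 4 and the
    bounds 3, which gives the factor 7.\<close>
  then have "(m + 1) * (2 * K) + 3 * m \<le> 2 * m * (2 * K) + 3 * m * K"
    using assms(3) by (intro add_mono mult_le_mono1) auto
  then have "(m + 1) * (2 * s * (z + d * n)) + 3 * m \<le> 7 * m * (s * (z + d * n))"
    by (simp add: K_def mult.assoc)
  then have "real ((m + 1) * (2 * s * (z + d * n)) + 3 * m) \<le> real (7 * m * (s * (z + d * n)))"
    by (simp only: of_nat_le_iff)
  also have "\<dots> = 7 * real m * (real s * real (z + d * n))"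
    by (simp only: of_nat_mult of_nat_numeral)
  also have "\<dots> \<le> 7 * real m * ((c\<^sub>2 * (1 / \<epsilon>) * L) * ((1 + c\<^sub>1) * E))"
    using s(2) zdn one by (intro mult_left_mono mult_mono) auto
  also have "\<dots> = 7 * c\<^sub>2 * (1 + c\<^sub>1) * (E * (1 / \<epsilon>) * real m * L)" by simp
  also have "\<dots> \<le> (1 + \<bar>7 * c\<^sub>2 * (1 + c\<^sub>1)\<bar>) * (E * (1 / \<epsilon>) * real m * L)"
    using E pos by (intro mult_right_mono) auto
  finally show ?thesis by (simp only: s_def E_def)
qed

text \<open>The dimension and column bounds in \<open>sparse_JLT\<close> hold for every outcome, so
  the operation bound does too, not merely with high probability.\<close>

theorem proposition6p1:
  fixes c\<^sub>1 c\<^sub>2 :: real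
  shows "\<exists>C::real. C > 0 \<and>
    (\<forall>(M :: 'w measure) (S :: 'w \<Rightarrow> real mat) (m::nat) (d::nat) (D::nat) (k::nat)
       (\<epsilon>::real) (\<delta>::real) (\<zeta>::real) (R::real) (P::sdp) (X::real mat) (z::nat).
       1 \<le> m \<longrightarrow> 1 \<le> D \<longrightarrow> 1 \<le> k \<longrightarrow> 0 < \<epsilon> \<longrightarrow> 0 < \<delta> \<longrightarrow> \<delta> < 1 \<longrightarrow> 0 < \<zeta> \<longrightarrow>
       sketchable_sdp m D P \<longrightarrow>
       optimal_point P X \<longrightarrow>
       z = Max (nnz ` set (objective P # constraints P)) \<longrightarrow>
       mat_rank X + mat_rank (objective P) + (\<Sum>B\<leftarrow>constraints P. mat_rank B) \<le> k \<longrightarrow>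
       sparse_JLT c\<^sub>1 c\<^sub>2 M d D S \<epsilon> \<delta> k \<longrightarrow>
       (\<forall>\<omega>\<in>space M.
          ereal_of_enat (sketching_complexity R \<epsilon> \<zeta> P (S \<omega>)) \<le>
          ereal C *
            (ereal (max (real z) (real D * (1 / \<epsilon>\<^sup>2) * ln (real k / \<delta>))
                    * (1 / \<epsilon>) * real m * ln (real k / \<delta>))
             + ereal_of_enat (sdp_complexity R m d \<zeta>))))"
proof (intro exI[of _ "1 + \<bar>7 * c\<^sub>2 * (1 + c\<^sub>1)\<bar>"] conjI allI impI ballI)
  show "0 < 1 + \<bar>7 * c\<^sub>2 * (1 + c\<^sub>1)\<bar>" by (simp add: add_pos_nonneg)
  fix M :: "'w measure" and S :: "'w \<Rightarrow> real mat" and m d D k :: nat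
    and \<epsilon> \<delta> \<zeta> R :: real and P X z \<omega>
  assume "1 \<le> m" "1 \<le> D" "1 \<le> k" "0 < \<epsilon>" "0 < \<delta>" "\<delta> < 1"
    and P: "sketchable_sdp m D P" and z: "z = Max (nnz ` set (objective P # constraints P))"
    and J: "sparse_JLT c\<^sub>1 c\<^sub>2 M d D S \<epsilon> \<delta> k" and \<omega>: "\<omega> \<in> space M"
  \<comment> \<open>The absolute value comes from the operation count; the extra 1 ensures
    \<open>1 \<le> ?C\<close>, so that the same constant also covers the cost of the solver.\<close>
  let ?C = "1 + \<bar>7 * c\<^sub>2 * (1 + c\<^sub>1)\<bar>" and ?L = "ln (real k / \<delta>)"
  let ?s = "nat \<lfloor>c\<^sub>2 * (1 / \<epsilon>) * ?L\<rfloor>"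
  let ?E = "max (real z) (real D * (1 / \<epsilon>\<^sup>2) * ?L) * (1 / \<epsilon>) * real m * ?L"
  let ?N = "(m + 1) * (2 * ?s * (z + d * D)) + 3 * m"
  have J': "S \<omega> \<in> carrier_mat d D" "1 \<le> d" "real d \<le> c\<^sub>1 * (1 / \<epsilon>\<^sup>2) * ?L"
    "1 \<le> c\<^sub>2 * (1 / \<epsilon>) * ?L"
    "\<And>j. j < D \<Longrightarrow> real (card {i. (i, j) \<in> nz_positions (S \<omega>)}) \<le> c\<^sub>2 * (1 / \<epsilon>) * ?L"
    using J \<omega> by (auto simp: sparse_JLT_def is_JLT_def)
  have "1 < real k / \<delta>" using \<open>1 \<le> k\<close> \<open>0 < \<delta>\<close> \<open>\<delta> < 1\<close> by (simp add: less_divide_eq)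
  then have L: "0 < ?L" by simp
  have "nnz B \<le> z" if "B \<in> set (objective P # constraints P)" for B
    unfolding z using that by (intro Max_ge) auto
  moreover have "card {i. (i, j) \<in> nz_positions (S \<omega>)} \<le> ?s" if "j < D" for j
    using J'(5)[OF that] by (simp add: le_nat_floor)
  ultimately have "sketching_complexity R \<epsilon> \<zeta> P (S \<omega>) \<le> enat ?N + sdp_complexity R m d \<zeta>"
    by (intro sketching_complexity_le[OF P J'(1)])
  then have "ereal_of_enat (sketching_complexity R \<epsilon> \<zeta> P (S \<omega>)) \<le>
      ereal_of_enat (enat ?N + sdp_complexity R m d \<zeta>)"
    by (simp only: ereal_of_enat_le_iff)
  also have "\<dots> = ereal (real ?N) + ereal_of_enat (sdp_complexity R m d \<zeta>)"
    by (simp only: ereal_of_enat_add ereal_of_enat_simps)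
  also have "\<dots> \<le> ereal (?C * ?E) + ereal ?C * ereal_of_enat (sdp_complexity R m d \<zeta>)"
  proof (rule add_mono)
    show "ereal (real ?N) \<le> ereal (?C * ?E)"
      unfolding ereal_less_eq
      by (rule operation_count_le[OF \<open>0 < \<epsilon>\<close> L \<open>1 \<le> m\<close> \<open>1 \<le> D\<close> J'(2-4)])
    have "1 * ereal_of_enat (sdp_complexity R m d \<zeta>) \<le> ereal ?C * ereal_of_enat (sdp_complexity R m d \<zeta>)"
      by (intro ereal_mult_right_mono) (auto simp: one_ereal_def)
    then show "ereal_of_enat (sdp_complexity R m d \<zeta>) \<le> ereal ?C * ereal_of_enat (sdp_complexity R m d \<zeta>)"
      by simp
  qed
  \<comment> \<open>The solver term may be infinite; distributivity in \<open>ereal\<close> holds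
    here because both summands are nonnegative.\<close>
  also have "\<dots> = ereal ?C * (ereal ?E + ereal_of_enat (sdp_complexity R m d \<zeta>))"
    using L \<open>0 < \<epsilon>\<close> by (subst ereal_right_distrib) (auto intro!: mult_nonneg_nonneg)
  finally show "ereal_of_enat (sketching_complexity R \<epsilon> \<zeta> P (S \<omega>)) \<le>
      ereal ?C * (ereal ?E + ereal_of_enat (sdp_complexity R m d \<zeta>))" .
qed

end
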